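(* Let $\alpha = o(\sqrt{n}/\log n)$ and $m = \mathrm{poly}(n)$. Any randomized single-pass streaming algorithm that $\alpha$-approximates the set cover problem (on instances consisting of $m$ subsets of the universe $[n]$ presented one by one in a stream) with probability at least $2/3$ requires $\Omega(mn/\alpha)$ bits of space.
   Context: Set cover: given a collection $\mathcal{S}$ of $m$ subsets of $[n]$, a set cover is a subcollection whose union is $[n]$; $\mathrm{opt}(\mathcal{S})$ is the minimum cardinality of a set cover. An algorithm $\alpha$-approximates set cover if on every input it outputs (the indices of) a collection of at most $\alpha\cdot\mathrm{opt}$ sets covering $[n]$, together with a certificate of covering that specifies, for each element $e\in[n]$, a set of the output used to cover $e$; for a randomized algorithm it is required that the certificate corresponds to a valid set cover with probability at least $2/3$. In the streaming model the sets arrive one at a time in an arbitrary (adversarial) order, and a single-pass algorithm reads the stream once; space is measured in bits. *)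

theory Defs
  imports "HOL-Probability.Probability" "HOL-Library.Landau_Symbols"
begin

text \<open>
  An instance is the list of its sets in order of arrival. A subcollection is given by the set of
  (0-based) positions of its members, so repeated sets are allowed.
\<close>

definition set_stream :: "nat \<Rightarrow> nat \<Rightarrow> nat set list \<Rightarrow> bool" where
  "set_stream n m S \<longleftrightarrow> length S = m \<and> (\<forall>X\<in>set S. X \<subseteq> {1..n})"

definition set_cover :: "nat \<Rightarrow> nat set list \<Rightarrow> nat set \<Rightarrow> bool" where
  "set_cover n S I \<longleftrightarrow> I \<subseteq> {..<length S} \<and> (\<Union>i\<in>I. S ! i) = {1..n}"

text \<open>Unspecified if there is no set cover at all; only used for instances that have one.\<close>

definition opt :: "nat \<Rightarrow> nat set list \<Rightarrow> nat" where
  "opt n S = (LEAST k. \<exists>I. set_cover n S I \<and> card I = k)"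

text \<open>
  An answer consists of the indices of the chosen sets and the certificate, which maps every
  element of the universe to the index of a chosen set that covers it.
\<close>

type_synonym answer = "nat set \<times> (nat \<Rightarrow> nat)"

definition approx_answer :: "real \<Rightarrow> nat \<Rightarrow> nat set list \<Rightarrow> answer \<Rightarrow> bool" where
  "approx_answer a n S ans \<longleftrightarrow>
     (case ans of (I, cert) \<Rightarrow>
        set_cover n S I \<and>
        real (card I) \<le> a * real (opt n S) \<and>
        (\<forall>e\<in>{1..n}. cert e \<in> I \<and> e \<in> S ! cert e))"

text \<open>
  A deterministic single-pass algorithm for fixed \<open>n\<close> and \<open>m\<close>. Its only access to the past is the
  memory content, a string of bits; the answer is computed from the final memory content.
  The time needed and the working space used while a single set is processed are not charged.
  The transition may depend on the position in the stream: in this way a probability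
  distribution over these algorithms also covers algorithms that toss fresh coins in every step
  without storing them.
\<close>

record stream_alg =
  init_mem :: "bool list"
  update_mem :: "nat \<Rightarrow> bool list \<Rightarrow> nat set \<Rightarrow> bool list"
  answer_of :: "bool list \<Rightarrow> answer"

fun run_from :: "stream_alg \<Rightarrow> nat \<Rightarrow> bool list \<Rightarrow> nat set list \<Rightarrow> bool list" where
  "run_from A t x [] = x"
| "run_from A t x (X # S) = run_from A (Suc t) (update_mem A t x X) S"

definition memory_after :: "stream_alg \<Rightarrow> nat set list \<Rightarrow> bool list" where
  "memory_after A S = run_from A 0 (init_mem A) S"

definition result :: "stream_alg \<Rightarrow> nat set list \<Rightarrow> answer" where
  "result A S = answer_of A (memory_after A S)"

text \<open>
  A randomized algorithm is a probability distribution over deterministic ones; its random bits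
  are not charged. Space is worst case over inputs, random choices and points of time.
\<close>

type_synonym rand_stream_alg = "stream_alg pmf"

definition uses_space :: "nat \<Rightarrow> nat \<Rightarrow> rand_stream_alg \<Rightarrow> nat \<Rightarrow> bool" where
  "uses_space n m P s \<longleftrightarrow>
     (\<forall>A\<in>set_pmf P. \<forall>S. set_stream n m S \<longrightarrow> (\<forall>t\<le>m. length (memory_after A (take t S)) \<le> s))"

definition approximates_set_cover :: "real \<Rightarrow> real \<Rightarrow> nat \<Rightarrow> nat \<Rightarrow> rand_stream_alg \<Rightarrow> bool" where
  "approximates_set_cover p a n m P \<longleftrightarrow>
     (\<forall>S. set_stream n m S \<and> (\<exists>I. set_cover n S I) \<longrightarrow>
        measure_pmf.prob P {A. approx_answer a n S (result A S)} \<ge> p)"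

end

theory Submission imports Defs begin

text \<open>
  Take about \<open>m / 2\<close> sets \<open>X i\<close> of size \<open>r\<close>, of order \<open>n / \<alpha>\<close>, with pairwise intersections smaller than
  \<open>r / (48 \<alpha>)\<close>; a greedy (Gilbert-Varshamov) choice of graphs of functions provides them. The stream
  consists of a partition of every \<open>X i\<close> into two parts, followed by the complement of one \<open>X i\<close>.
  Three sets suffice for a cover, and the at most \<open>3 \<alpha>\<close> chosen sets other than the two parts of
  \<open>X i\<close> cover only a small fraction of \<open>X i\<close>. So the certificate reveals the partition of \<open>X i\<close>
  up to \<open>r / 16\<close> errors. As the last set is not known in advance, the memory before it must
  determine a constant fraction of the roughly \<open>r m / 2\<close> bits describing the partitions.
  For \<open>m = 2\<close> there is no room for this construction; there the answer alone already needs
  almost \<open>n\<close> bits.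
\<close>

section \<open>Nearly disjoint sets by greedy choice\<close>

text \<open>Each chosen element rules out at most \<open>B\<close> elements, so before every choice
  fewer than \<open>card U\<close> elements are ruled out.\<close>

lemma greedy_selection:
  fixes Q :: "'a \<Rightarrow> 'a \<Rightarrow> bool"
  assumes "finite U" "U \<noteq> {}"
    and B: "\<And>x. x \<in> U \<Longrightarrow> card {y\<in>U. Q x y} \<le> B"
    and K: "K * B \<le> card U"
  shows "\<exists>f::nat \<Rightarrow> 'a. (\<forall>i<K. f i \<in> U) \<and> (\<forall>i<K. \<forall>j<i. \<not> Q (f j) (f i))"
  using K
proof (induction K)
  case 0
  show ?case by simp
next
  case (Suc k)
  then obtain f where f: "\<forall>i<k. f i \<in> U" "\<forall>i<k. \<forall>j<i. \<not> Q (f j) (f i)"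
    by auto
  let ?C = "\<Union>j<k. {y\<in>U. Q (f j) y}"
  have "card ?C \<le> (\<Sum>j<k. card {y\<in>U. Q (f j) y})"
    by (rule card_UN_le) simp
  also have "\<dots> \<le> (\<Sum>j<k. B)"
    using f B by (intro sum_mono) auto
  finally have "card ?C \<le> k * B" by simp
  \<comment> \<open>For \<open>B > 0\<close> strictness comes from the spare summand in
    \<open>Suc k * B\<close>; for \<open>B = 0\<close> it is the nonemptiness of
    \<open>U\<close>.\<close>
  moreover have "k * B < card U"
    using Suc.prems assms(1,2) by (cases "B = 0") (auto simp: card_gt_0_iff)
  ultimately have "card ?C < card U" by simp
  moreover have "finite ?C" using assms(1) by simp
  ultimately have "\<not> U \<subseteq> ?C" using card_mono[of ?C U] by linarith
  then obtain y where y: "y \<in> U" "y \<notin> ?C" by blast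
  have "(\<forall>i<Suc k. (f(k := y)) i \<in> U) \<and> (\<forall>i<Suc k. \<forall>j<i. \<not> Q ((f(k := y)) j) ((f(k := y)) i))"
    using f y by (auto simp: less_Suc_eq)
  then show ?case by blast
qed

text \<open>Union bound over the sets \<open>T\<close> of \<open>t\<close> places: \<open>g\<close>
  is forced on \<open>T\<close> and free in the other \<open>r - t\<close> places.\<close>

lemma card_agreeing_functions_le:
  fixes r t q :: nat
  assumes f: "f \<in> {..<r} \<rightarrow>\<^sub>E {..<q}" and "t \<le> r"
  shows "card {g \<in> {..<r} \<rightarrow>\<^sub>E {..<q}. t \<le> card {a\<in>{..<r}. f a = g a}} \<le> (r choose t) * q ^ (r - t)"
proof -
  let ?T = "{T. T \<subseteq> {..<r} \<and> card T = t}"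
  let ?G = "\<lambda>T. PiE {..<r} (\<lambda>a. if a \<in> T then {f a} else {..<q})"
  have sub: "{g \<in> {..<r} \<rightarrow>\<^sub>E {..<q}. t \<le> card {a\<in>{..<r}. f a = g a}} \<subseteq> (\<Union>T\<in>?T. ?G T)"
  proof
    fix g assume g: "g \<in> {g \<in> {..<r} \<rightarrow>\<^sub>E {..<q}. t \<le> card {a\<in>{..<r}. f a = g a}}"
    then obtain T where "T \<subseteq> {a\<in>{..<r}. f a = g a}" "card T = t"
      by (auto intro: obtain_subset_with_card_n)
    with g show "g \<in> (\<Union>T\<in>?T. ?G T)"
      by (intro UN_I[of T]) (auto simp: PiE_iff)
  qed
  have cardG: "card (?G T) = q ^ (r - t)" if "T \<in> ?T" for T
  proof -
    have "card (?G T) = (\<Prod>a<r. if a \<in> T then 1 else q)"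
      by (subst card_PiE) (auto intro!: prod.cong)
    also have "\<dots> = q ^ card ({..<r} - T)"
      by (simp add: prod.If_cases Diff_eq)
    also have "card ({..<r} - T) = r - t"
      using that by (subst card_Diff_subset) (auto intro: finite_subset)
    finally show ?thesis .
  qed
  have "card {g \<in> {..<r} \<rightarrow>\<^sub>E {..<q}. t \<le> card {a\<in>{..<r}. f a = g a}} \<le> card (\<Union>T\<in>?T. ?G T)"
    using sub by (rule card_mono[rotated]) (auto intro!: finite_PiE)
  also have "\<dots> \<le> (\<Sum>T\<in>?T. card (?G T))"
    by (rule card_UN_le) simp
  also have "\<dots> = (r choose t) * q ^ (r - t)"
    using cardG by (simp add: n_subsets)
  finally show ?thesis .
qed

text \<open>The quotient of the two powers by factorial is a single term of the exponential series
  at \<open>t\<close>, and \<open>exp 1\<close> is at most 3.\<close>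

lemma self_power_le_fact: "real t ^ t \<le> 3 ^ t * fact t"
proof -
  have "real t ^ t / fact t \<le> exp (real t)"
  proof -
    have "sum (\<lambda>k. inverse (fact k) * real t ^ k) {t} \<le> suminf (\<lambda>k. inverse (fact k) * real t ^ k)"
      by (rule sum_le_suminf) (auto intro: summable_exp)
    also have "\<dots> = exp (real t)"
      by (simp add: exp_def divide_inverse mult.commute scaleR_conv_of_real)
    finally show ?thesis by (simp add: field_simps)
  qed
  also have "exp (real t) = exp 1 ^ t"
    by (simp flip: exp_of_nat_mult)
  also have "\<dots> \<le> 3 ^ t"
    by (intro power_mono exp_le) simp
  finally show ?thesis by (simp add: field_simps)
qed

text \<open>The binomial coefficient is at most \<open>r ^ t / fact t\<close>, hence at most
  \<open>(3 * r / t) ^ t\<close>; the constant 6 leaves the factor \<open>2 ^ t\<close> to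
  spare.\<close>

lemma binomial_le_power_of_ratio:
  fixes r t q :: nat
  assumes "t > 0" "6 * r \<le> t * q"
  shows "2 ^ t * (r choose t) \<le> q ^ t"
proof -
  have "real ((r choose t) * fact t) \<le> real (r ^ t)"
    using binomial_fact_pow[of r t] by (simp only: of_nat_le_iff)
  then have b: "real (r choose t) * fact t \<le> real r ^ t" by simp
  have "real t ^ t * (2 ^ t * real (r choose t)) \<le> 3 ^ t * fact t * (2 ^ t * real (r choose t))"
    by (intro mult_right_mono self_power_le_fact) simp
  also have "\<dots> = 6 ^ t * (real (r choose t) * fact t)"
    by (simp add: mult_ac flip: power_mult_distrib)
  also have "\<dots> \<le> 6 ^ t * real r ^ t"
    by (intro mult_left_mono b) simp
  also have "\<dots> = real (6 * r) ^ t" by (simp add: power_mult_distrib)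
  also have "\<dots> \<le> real (t * q) ^ t"
    using assms(2) by (intro power_mono) (simp_all only: of_nat_le_iff of_nat_0_le_iff)
  also have "\<dots> = real t ^ t * real (q ^ t)" by (simp add: power_mult_distrib)
  finally have "2 ^ t * real (r choose t) \<le> real (q ^ t)"
    using assms(1) by (simp del: of_nat_power)
  then have "real (2 ^ t * (r choose t)) \<le> real (q ^ t)" by simp
  then show ?thesis by (simp only: of_nat_le_iff)
qed

text \<open>\<open>X i\<close> is the graph of a function from \<open>r\<close> places to
  \<open>q\<close> values, so common elements of two sets are agreements of two functions. At most a
  fraction \<open>1 / 2 ^ t\<close> of all functions agrees with a given one in \<open>t\<close> or
  more places, so the greedy choice can make \<open>2 ^ t\<close> steps.\<close>

lemma exists_nearly_disjoint_family:
  fixes r t q n K :: nat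
  assumes t: "0 < t" "t \<le> r" and q: "6 * r \<le> t * q" and n: "r * q \<le> n" and K: "K \<le> 2 ^ t"
  shows "\<exists>X::nat \<Rightarrow> nat set. (\<forall>i<K. X i \<subseteq> {1..n} \<and> card (X i) = r) \<and>
           (\<forall>i<K. \<forall>j<K. i \<noteq> j \<longrightarrow> card (X i \<inter> X j) < t)"
proof -
  let ?U = "{..<r} \<rightarrow>\<^sub>E {..<q}"
  let ?agree = "\<lambda>f g. {a\<in>{..<r}. f a = (g a :: nat)}"
  have "q > 0" using t q by (intro gr0I) auto
  have cU: "card ?U = q ^ r" by (simp add: card_PiE)
  have "?U \<noteq> {}" using \<open>q > 0\<close> by (auto simp: PiE_eq_empty_iff)
  have "K * ((r choose t) * q ^ (r - t)) \<le> 2 ^ t * ((r choose t) * q ^ (r - t))"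
    using K by (rule mult_right_mono) simp
  also have "\<dots> \<le> q ^ t * q ^ (r - t)"
    using mult_right_mono[OF binomial_le_power_of_ratio[OF t(1) q], of "q ^ (r - t)"]
    by (simp add: mult.assoc)
  also have "\<dots> = card ?U" using t(2) cU by (simp flip: power_add)
  finally have "K * ((r choose t) * q ^ (r - t)) \<le> card ?U" .
  moreover have "finite ?U" by (simp add: finite_PiE)
  ultimately have "\<exists>f::nat \<Rightarrow> nat \<Rightarrow> nat. (\<forall>i<K. f i \<in> ?U) \<and> (\<forall>i<K. \<forall>j<i. \<not> t \<le> card (?agree (f j) (f i)))"
    using \<open>?U \<noteq> {}\<close> card_agreeing_functions_le[OF _ t(2)]
    by (intro greedy_selection[where B = "(r choose t) * q ^ (r - t)"])
  then obtain f :: "nat \<Rightarrow> nat \<Rightarrow> nat"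
    where f: "\<forall>i<K. f i \<in> ?U" and f': "\<forall>i<K. \<forall>j<i. \<not> t \<le> card (?agree (f j) (f i))"
    by blast
  \<comment> \<open>The pair of \<open>a\<close> and \<open>c < q\<close> is encoded as
    \<open>a * q + c + 1\<close>, since the universe starts at 1.\<close>
  define X where "X i = (\<lambda>a. a * q + f i a + 1) ` {..<r}" for i
  have lt: "f i a < q" if "i < K" "a < r" for i a
    using f that by (auto simp: PiE_iff)
  have eq: "a = b \<and> c = d" if "a * q + c = b * q + d" "c < q" "d < q" for a b c d :: nat
  proof -
    have "(a * q + c) div q = a" "(b * q + d) div q = b" using that(2,3) by simp_all
    with that(1) show ?thesis by simp
  qed
  have X1: "X i \<subseteq> {1..n} \<and> card (X i) = r" if i: "i < K" for i
  proof
    have "a * q + f i a + 1 \<le> n" if "a < r" for a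
    proof -
      have "a * q + f i a + 1 \<le> Suc a * q" using lt[OF i that] by simp
      also have "\<dots> \<le> r * q" using that by (intro mult_right_mono) auto
      finally show ?thesis using n by simp
    qed
    then show "X i \<subseteq> {1..n}" by (auto simp: X_def)
    have "inj_on (\<lambda>a. a * q + f i a + 1) {..<r}"
    proof (rule inj_onI)
      fix a b assume "a \<in> {..<r}" "b \<in> {..<r}" "a * q + f i a + 1 = b * q + f i b + 1"
      then show "a = b" using eq[of a "f i a" b "f i b"] lt[OF i] by simp
    qed
    then show "card (X i) = r" by (simp add: X_def card_image)
  qed
  have X2: "X i \<inter> X j \<subseteq> (\<lambda>a. a * q + f i a + 1) ` ?agree (f i) (f j)" if "i < K" "j < K" for i j
  proof
    fix x assume "x \<in> X i \<inter> X j"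
    then obtain a b where ab: "a < r" "b < r" "x = a * q + f i a + 1" "x = b * q + f j b + 1"
      by (auto simp: X_def)
    then have "a = b \<and> f i a = f j b"
      using lt[OF that(1)] lt[OF that(2)] by (intro eq[of a "f i a" b "f j b"]) simp_all
    with ab show "x \<in> (\<lambda>a. a * q + f i a + 1) ` ?agree (f i) (f j)"
      by (intro image_eqI[where x = a]) auto
  qed
  have X3: "card (X i \<inter> X j) \<le> card (?agree (f i) (f j))" if "i < K" "j < K" for i j
    by (rule order.trans[OF card_mono[OF _ X2[OF that]] card_image_le]) auto
  have "card (X i \<inter> X j) < t" if "i < K" "j < K" "i \<noteq> j" for i j
  proof (cases "j < i")
    case True
    then have "card (?agree (f j) (f i)) < t" using f'[rule_format, OF that(1)] by (simp add: not_le)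
    with X3[OF that(2,1)] show ?thesis by (simp only: Int_commute)
  next
    case False
    with that(3) have "i < j" by simp
    then have "card (?agree (f i) (f j)) < t" using f'[rule_format, OF that(2)] by (simp add: not_le)
    with X3[OF that(1,2)] show ?thesis by simp
  qed
  with X1 show ?thesis by blast
qed

section \<open>Counting Hamming balls and memory states\<close>

text \<open>Give each \<open>Y\<close> the weight 1/4 to the power of its distance from
  \<open>G\<close>. All weights sum to \<open>(5/4) ^ r\<close>, and each member of the ball weighs
  at least \<open>(1/4) ^ k\<close>. Squaring avoids the exponent \<open>r / 2\<close>, which need
  not be an integer.\<close>

lemma card_hamming_ball_le:
  assumes X: "finite X" "card X = r" and G: "G \<subseteq> X" and k: "16 * k \<le> r"
  shows "(card {Y. Y \<subseteq> X \<and> card (sym_diff Y G) \<le> k})\<^sup>2 \<le> 2 ^ r"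
proof -
  let ?B = "{Y. Y \<subseteq> X \<and> card (sym_diff Y G) \<le> k}"
  have bij: "bij_betw (\<lambda>Y. sym_diff Y G) (Pow X) (Pow X)"
    by (rule bij_betw_byWitness[where f' = "\<lambda>Y. sym_diff Y G"]) (use G in auto)
  have "real (card ?B) * (1/4) ^ k = (\<Sum>Y\<in>?B. (1/4) ^ k)" by simp
  also have "\<dots> \<le> (\<Sum>Y\<in>?B. (1/4) ^ card (sym_diff Y G))"
    by (intro sum_mono power_decreasing) auto
  also have "\<dots> \<le> (\<Sum>Y\<in>Pow X. (1/4) ^ card (sym_diff Y G))"
    using X by (intro sum_mono2) auto
  also have "\<dots> = (\<Sum>Z\<in>Pow X. (1/4) ^ card Z)"
    by (rule sum.reindex_bij_betw[OF bij])
  also have "\<dots> = (\<Prod>x\<in>X. 1/4 + 1)"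
    using X by (subst prod_add) auto
  also have "\<dots> = (5/4) ^ r" using X by simp
  finally have "real (card ?B) \<le> (5/4) ^ r * 4 ^ k" by (simp add: field_simps)
  then have "(real (card ?B))\<^sup>2 \<le> ((5/4) ^ r * 4 ^ k)\<^sup>2" by (rule power_mono) simp
  also have "\<dots> = (25/16) ^ r * 16 ^ k"
    by (simp add: power_mult_distrib power_divide power_even_eq flip: power_mult)
       (simp add: power_mult mult.commute[of _ 2])
  \<comment> \<open>The radius bound \<open>r / 16\<close> enters here: \<open>(32/25) ^ 16\<close>
    exceeds 16, and 32/25 is what is missing from 25/16 to 2.\<close>
  also have "(16::real) ^ k \<le> (32/25) ^ r"
  proof -
    have "(16::real) ^ k \<le> ((32/25) ^ 16) ^ k"
      by (rule power_mono) (simp_all add: power_divide)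
    also have "\<dots> = (32/25) ^ (16 * k)" by (rule power_mult[symmetric])
    also have "\<dots> \<le> (32/25) ^ r" using k by (intro power_increasing) auto
    finally show ?thesis .
  qed
  also have "(25/16) ^ r * (32/25) ^ r = (2::real) ^ r"
    by (simp flip: power_mult_distrib)
  finally have "real ((card ?B)\<^sup>2) \<le> real (2 ^ r)" by simp
  then show ?thesis by (simp only: of_nat_le_iff)
qed

lemma card_bool_lists_length_le: "card {l :: bool list. length l \<le> s} \<le> 2 ^ Suc s"
proof -
  have "card {l :: bool list. set l \<subseteq> UNIV \<and> length l \<le> s} = (\<Sum>i\<le>s. 2 ^ i)"
    by (subst card_lists_length_le) (simp_all add: card_UNIV_bool)
  also have "\<dots> \<le> (2 ^ Suc s :: nat)"
    using sum_power2[of "Suc s"] by (simp add: lessThan_Suc_atMost[symmetric] atLeast0LessThan del: power_Suc)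
  finally show ?thesis by simp
qed

lemma finite_bool_lists_length_le: "finite {l :: bool list. length l \<le> s}"
  using finite_lists_length_le[of "UNIV :: bool set" s] by simp

text \<open>An averaging argument: elements with \<open>2 * c x < K\<close> contribute at most
  \<open>K\<close> to the sum of \<open>2 * c x\<close>, the others at most \<open>2 * K\<close>,
  while the average is at least \<open>4 * K / 3\<close>.\<close>

lemma card_half_le:
  fixes c :: "'a \<Rightarrow> nat"
  assumes "finite U" "K > 0" and c: "\<And>x. x \<in> U \<Longrightarrow> c x \<le> K"
    and avg: "2 * (card U * K) \<le> 3 * (\<Sum>x\<in>U. c x)"
  shows "card U \<le> 3 * card {x\<in>U. K \<le> 2 * c x}"
proof -
  let ?V = "{x\<in>U. K \<le> 2 * c x}"
  have "2 * (\<Sum>x\<in>U. c x) = (\<Sum>x\<in>U. 2 * c x)" by (simp add: sum_distrib_left)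
  also have "\<dots> \<le> (\<Sum>x\<in>U. K + (if K \<le> 2 * c x then K else 0))"
    by (rule sum_mono) (use c in force)
  also have "\<dots> = card U * K + card ?V * K"
    using assms(1) by (simp add: sum.distrib flip: sum.inter_filter)
  finally have "card U * K \<le> 3 * card ?V * K" using avg by linarith
  then show ?thesis using assms(2) by simp
qed

text \<open>
  Counting replaces the usual information-theoretic argument: a memory state, together with the
  set of at least \<open>K div 2\<close> coordinates on which the guess succeeds, leaves few possible inputs.
\<close>

lemma memory_lower_bound:
  fixes K r s :: nat and X :: "nat \<Rightarrow> 'a set" and mem :: "(nat \<Rightarrow> 'a set) \<Rightarrow> bool list"
    and guess :: "bool list \<Rightarrow> nat \<Rightarrow> 'a set set"
  defines "U \<equiv> PiE {..<K} (\<lambda>i. Pow (X i))"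
  assumes X: "\<And>i. i < K \<Longrightarrow> finite (X i) \<and> card (X i) = r"
    and mem: "\<And>x. x \<in> U \<Longrightarrow> length (mem x) \<le> s"
    and guess: "\<And>l i. i < K \<Longrightarrow> guess l i \<subseteq> Pow (X i) \<and> (card (guess l i))\<^sup>2 \<le> 2 ^ r"
    and success: "2 * (card U * K) \<le> 3 * card {(x, i) \<in> U \<times> {..<K}. x i \<in> guess (mem x) i}"
  shows "K * r \<le> 4 * (s + K + 3)"
proof (cases "K = 0")
  case False
  \<comment> \<open>\<open>C\<close> is 2 to the power \<open>3 * K * r / 4\<close>: at least half
    of the coordinates have at most \<open>2 ^ (r / 2)\<close> candidates, the others
    \<open>2 ^ r\<close>. Fourth powers keep all exponents integral.\<close>
  define C where "C = root 4 (2 ^ (3 * K * r))"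
  have C4: "C ^ 4 = 2 ^ (3 * K * r)" by (simp add: C_def)
  have C0: "C \<ge> 0" by (simp add: C_def)
  have finU: "finite U" using X by (auto simp: U_def intro!: finite_PiE)
  have cU: "card U = 2 ^ (K * r)"
    using X by (simp add: U_def card_PiE card_Pow power_mult mult.commute[of K])
  define c where "c x = card {i\<in>{..<K}. x i \<in> guess (mem x) i}" for x
  have "{(x, i) \<in> U \<times> {..<K}. x i \<in> guess (mem x) i} = (SIGMA x:U. {i\<in>{..<K}. x i \<in> guess (mem x) i})"
    by auto
  then have "card {(x, i) \<in> U \<times> {..<K}. x i \<in> guess (mem x) i} = (\<Sum>x\<in>U. c x)"
    using finU by (simp add: c_def card_SigmaI)
  moreover have "c x \<le> K" for x
    unfolding c_def by (rule order.trans[OF card_mono[of "{..<K}"]]) auto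
  ultimately have half: "card U \<le> 3 * card {x\<in>U. K \<le> 2 * c x}"
    using card_half_le[OF finU, of K c] success False by simp
  let ?L = "{l :: bool list. length l \<le> s}" and ?J = "{J. J \<subseteq> {..<K} \<and> K \<le> 2 * card J}"
  \<comment> \<open>The inputs that memory content \<open>l\<close> allows if the guess is known to
    succeed on \<open>J\<close>.\<close>
  let ?W = "\<lambda>l J. PiE {..<K} (\<lambda>i. if i \<in> J then guess l i else Pow (X i))"
  have finJ: "finite ?J" by simp
  have cardJ: "card ?J \<le> 2 ^ K"
    using card_mono[of "Pow {..<K}" ?J] by (auto simp: card_Pow)
  have W: "real (card (?W l J)) \<le> C" if J: "J \<in> ?J" for l J
  proof -
    have "card (?W l J) ^ 4 = (\<Prod>i<K. card (if i \<in> J then guess l i else Pow (X i)) ^ 4)"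
      by (simp add: card_PiE prod_power_distrib)
    also have "\<dots> \<le> (\<Prod>i<K. if i \<in> J then 2 ^ (2 * r) else 2 ^ (4 * r))"
    proof (rule prod_mono, intro conjI)
      fix i assume "i \<in> {..<K}"
      then have "i < K" by simp
      have "((card (guess l i))\<^sup>2)\<^sup>2 \<le> (2 ^ r)\<^sup>2"
        using guess[OF \<open>i < K\<close>] by (intro power_mono) auto
      then show "card (if i \<in> J then guess l i else Pow (X i)) ^ 4
          \<le> (if i \<in> J then 2 ^ (2 * r) else 2 ^ (4 * r))"
        using X[OF \<open>i < K\<close>] by (auto simp: card_Pow mult.commute simp flip: power_mult)
    qed simp
    also have "\<dots> = 2 ^ (2 * r * card J + 4 * r * card ({..<K} - J))"
    proof -
      have "{..<K} \<inter> J = J" using J by auto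
      then show ?thesis
        by (simp add: prod.If_cases Diff_eq power_add flip: power_mult)
    qed
    also have "\<dots> \<le> 2 ^ (3 * K * r)"
    proof (rule power_increasing)
      have "card ({..<K} - J) = K - card J" "card J \<le> K"
        using J card_mono[of "{..<K}" J] by (auto simp: card_Diff_subset finite_subset)
      then have "2 * card J + 4 * card ({..<K} - J) \<le> 3 * K" using J by auto
      then have "(2 * card J + 4 * card ({..<K} - J)) * r \<le> 3 * K * r" by (rule mult_right_mono) simp
      then show "2 * r * card J + 4 * r * card ({..<K} - J) \<le> 3 * K * r" by (simp add: algebra_simps)
    qed simp
    finally have "real (card (?W l J) ^ 4) \<le> real (2 ^ (3 * K * r))" by (simp only: of_nat_le_iff)
    then have "real (card (?W l J)) ^ 4 \<le> C ^ 4" by (simp add: C4)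
    then show ?thesis using C0 by (simp add: power_mono_iff)
  qed
  have "{x\<in>U. K \<le> 2 * c x} \<subseteq> (\<Union>l\<in>?L. \<Union>J\<in>?J. ?W l J)"
  proof
    fix x assume x: "x \<in> {x\<in>U. K \<le> 2 * c x}"
    let ?S = "{i\<in>{..<K}. x i \<in> guess (mem x) i}"
    have "x \<in> ?W (mem x) ?S" using x by (auto simp: U_def PiE_iff)
    moreover have "?S \<in> ?J" using x by (auto simp: c_def)
    moreover have "mem x \<in> ?L" using mem x by auto
    ultimately show "x \<in> (\<Union>l\<in>?L. \<Union>J\<in>?J. ?W l J)" by blast
  qed
  then have "card {x\<in>U. K \<le> 2 * c x} \<le> card (\<Union>l\<in>?L. \<Union>J\<in>?J. ?W l J)"
  proof (rule card_mono[rotated])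
    have "finite (?W l J)" for l J
    proof (rule finite_PiE)
      fix i assume "i \<in> {..<K}"
      then have "finite (Pow (X i))" "guess l i \<subseteq> Pow (X i)" using X guess by auto
      then show "finite (if i \<in> J then guess l i else Pow (X i))"
        using finite_subset by auto
    qed simp
    then show "finite (\<Union>l\<in>?L. \<Union>J\<in>?J. ?W l J)" using finJ finite_bool_lists_length_le by blast
  qed
  also have "\<dots> \<le> (\<Sum>l\<in>?L. \<Sum>J\<in>?J. card (?W l J))"
    by (intro order.trans[OF card_UN_le] sum_mono card_UN_le finJ finite_bool_lists_length_le)
  finally have "real (card {x\<in>U. K \<le> 2 * c x}) \<le> (\<Sum>l\<in>?L. \<Sum>J\<in>?J. real (card (?W l J)))"
    by (simp only: of_nat_le_iff flip: of_nat_sum)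
  also have "\<dots> \<le> (\<Sum>l\<in>?L. \<Sum>J\<in>?J. C)"
    by (intro sum_mono W)
  also have "\<dots> = real (card ?L) * (real (card ?J) * C)" by simp
  also have "\<dots> \<le> 2 ^ Suc s * (2 ^ K * C)"
    using card_bool_lists_length_le[of s] cardJ C0
    by (intro mult_mono mult_right_mono) (simp_all add: numeral_power_le_of_nat_cancel_iff
          of_nat_le_numeral_power_cancel_iff del: power_Suc)
  finally have "real (card {x\<in>U. K \<le> 2 * c x}) \<le> 2 ^ Suc s * (2 ^ K * C)" .
  moreover have "real (card U) \<le> 3 * real (card {x\<in>U. K \<le> 2 * c x})"
    using half by linarith
  moreover have "2 ^ Suc s * (2 ^ K * C) \<ge> 0" using C0 by simp
  \<comment> \<open>The factor 3 is rounded up to 4, so that only powers of two stand next to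
    \<open>C\<close>.\<close>
  ultimately have "real (card U) \<le> 4 * (2 ^ Suc s * (2 ^ K * C))" by linarith
  also have "\<dots> = 2 ^ (s + K + 3) * C" by (simp add: power_add)
  finally have "(2 ^ (K * r)) ^ 4 \<le> (2 ^ (s + K + 3) * C) ^ 4"
    unfolding cU by (intro power_mono) simp_all
  also have "\<dots> = 2 ^ (4 * (s + K + 3) + 3 * K * r)"
    by (simp add: power_mult_distrib C4 power_add mult.commute flip: power_mult)
  finally have "(2::real) ^ (4 * (K * r)) \<le> 2 ^ (4 * (s + K + 3) + 3 * K * r)"
    by (simp add: mult.commute flip: power_mult)
  then have "4 * (K * r) \<le> 4 * (s + K + 3) + 3 * K * r"
    by (subst (asm) power_increasing_iff) simp_all
  then show ?thesis by simp
qed simp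

section \<open>Fixing the random choices, and the bound linear in \<open>n\<close>\<close>

text \<open>The easy direction of Yao's principle: the expected number of successes is at least
  \<open>p * card Z\<close>, and some algorithm in the support does no worse than the
  expectation.\<close>

lemma exists_good_realisation:
  fixes Q :: "'z \<Rightarrow> 'a \<Rightarrow> bool"
  assumes "finite Z" and p: "\<And>z. z \<in> Z \<Longrightarrow> p \<le> measure_pmf.prob P {A. Q z A}"
  shows "\<exists>A\<in>set_pmf P. p * real (card Z) \<le> real (card {z\<in>Z. Q z A})"
proof (rule ccontr)
  assume contra: "\<not> ?thesis"
  let ?c = "\<lambda>A. \<Sum>z\<in>Z. indicator {A. Q z A} A :: real"
  have c: "?c A = real (card {z\<in>Z. Q z A})" for A
    using assms(1) by (simp add: indicator_def sum.If_cases Int_def)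
  have "measure_pmf.expectation P ?c < p * real (card Z)"
    using contra by (intro measure_pmf.expectation_less) (auto simp: AE_measure_pmf_iff c
      intro!: measure_pmf.integrable_const_bound[where B = "real (card Z)"] card_mono assms(1))
  moreover have "measure_pmf.expectation P ?c = (\<Sum>z\<in>Z. measure_pmf.prob P {A. Q z A})"
    by (subst Bochner_Integration.integral_sum)
      (auto intro!: measure_pmf.integrable_const_bound[where B = 1])
  moreover have "\<dots> \<ge> (\<Sum>z\<in>Z. p)" by (rule sum_mono) (rule p)
  ultimately show False by (simp add: mult.commute)
qed

lemma run_from_append: "run_from A t x (S @ T) = run_from A (t + length S) (run_from A t x S) T"
  by (induction S arbitrary: t x) simp_all

lemma memory_after_snoc:
  "memory_after A (S @ [X]) = update_mem A (length S) (memory_after A S) X"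
  by (simp add: memory_after_def run_from_append)

lemma opt_le_card: "set_cover n S I \<Longrightarrow> opt n S \<le> card I"
  unfolding opt_def by (rule Least_le) blast

text \<open>On a stream of copies of the universe the optimum is at most 1, while a valid answer,
  which exists as \<open>p > 0\<close>, chooses at least one set. This bounds the ratio from below,
  where the growth condition of the theorem only bounds it from above.\<close>

lemma approximation_ratio_ge_1:
  assumes P: "approximates_set_cover p a n m P" and "p > 0" "n > 0" "m > 0"
  shows "a \<ge> 1"
proof -
  let ?S = "replicate m {1..n}"
  have S: "set_stream n m ?S" by (auto simp: set_stream_def)
  have cov: "set_cover n ?S {0}" using \<open>m > 0\<close> by (auto simp: set_cover_def)
  with S P have "measure_pmf.prob P {A. approx_answer a n ?S (result A ?S)} \<ge> p"
    unfolding approximates_set_cover_def by blast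
  with \<open>p > 0\<close> have "{A. approx_answer a n ?S (result A ?S)} \<noteq> {}"
    by (intro notI) simp
  then obtain I cert where ans: "approx_answer a n ?S (I, cert)" by (metis (mono_tags) Collect_empty_eq surj_pair)
  then have "I \<noteq> {}" "finite I" using \<open>n > 0\<close>
    by (auto simp: approx_answer_def set_cover_def intro: finite_subset)
  then have "1 \<le> real (card I)" by (simp add: Suc_leI card_gt_0_iff)
  then have ge: "1 \<le> a * real (opt n ?S)" using ans by (simp add: approx_answer_def)
  have "opt n ?S \<le> 1" using opt_le_card[OF cov] by simp
  show ?thesis
  proof (cases "a \<ge> 0")
    case True
    then have "a * real (opt n ?S) \<le> a * 1" using \<open>opt n ?S \<le> 1\<close> by (intro mult_left_mono) auto
    with ge show ?thesis by simp
  next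
    case False
    then have "a * real (opt n ?S) \<le> 0" by (intro mult_nonpos_nonneg) auto
    with ge show ?thesis by simp
  qed
qed

text \<open>
  The set cover of a partition into two parts has only one valid certificate, so the final memory
  content must distinguish at least two thirds of the \<open>2 ^ n\<close> partitions.
\<close>

lemma space_ge_universe:
  assumes P: "approximates_set_cover (2 / 3) a n m P" and sp: "uses_space n m P s" and "m \<ge> 2"
  shows "n \<le> s + 2"
proof -
  \<comment> \<open>The empty sets only fill the stream up to length \<open>m\<close>; no
    certificate can point to them.\<close>
  define S where "S Y = [Y, {1..n} - Y] @ replicate (m - 2) {}" for Y
  let ?Z = "Pow {1..n}"
  let ?Q = "\<lambda>Y A. approx_answer a n (S Y) (result A (S Y))"
  have S: "set_stream n m (S Y)" if "Y \<in> ?Z" for Y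
    using that \<open>m \<ge> 2\<close> by (auto simp: set_stream_def S_def)
  have "set_cover n (S Y) {0, 1}" if "Y \<in> ?Z" for Y
    using that by (auto simp: set_cover_def S_def)
  with S P have "2 / 3 \<le> measure_pmf.prob P {A. ?Q Y A}" if "Y \<in> ?Z" for Y
    using that unfolding approximates_set_cover_def by blast
  then obtain A where A: "A \<in> set_pmf P" "2 / 3 * real (card ?Z) \<le> real (card {Y\<in>?Z. ?Q Y A})"
    using exists_good_realisation[of ?Z "2 / 3" P ?Q] by auto
  have dec: "{e\<in>{1..n}. snd (result A (S Y)) e = 0} = Y" if "Y \<in> ?Z" "?Q Y A" for Y
  proof -
    have "e \<in> Y \<longleftrightarrow> snd (result A (S Y)) e = 0" if e: "e \<in> {1..n}" for e
    proof -
      let ?c = "snd (result A (S Y)) e"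
      have "?c < length (S Y)" "e \<in> S Y ! ?c"
        using \<open>?Q Y A\<close> e by (auto simp: approx_answer_def set_cover_def split: prod.splits)
      then show ?thesis
        by (cases "?c = 0"; cases "?c = 1")
          (auto simp: S_def nth_Cons nth_append split: nat.splits if_splits)
    qed
    then show ?thesis using \<open>Y \<in> ?Z\<close> by auto
  qed
  have "inj_on (\<lambda>Y. memory_after A (S Y)) {Y\<in>?Z. ?Q Y A}"
  proof (rule inj_onI)
    fix Y Y' assume *: "Y \<in> {Y\<in>?Z. ?Q Y A}" "Y' \<in> {Y\<in>?Z. ?Q Y A}"
      "memory_after A (S Y) = memory_after A (S Y')"
    have "Y = {e\<in>{1..n}. snd (result A (S Y)) e = 0}" using dec[of Y] *(1) by blast
    also have "\<dots> = {e\<in>{1..n}. snd (result A (S Y')) e = 0}" using *(3) by (simp add: result_def)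
    also have "\<dots> = Y'" using dec[of Y'] *(2) by blast
    finally show "Y = Y'" .
  qed
  moreover have "(\<lambda>Y. memory_after A (S Y)) ` {Y\<in>?Z. ?Q Y A} \<subseteq> {l. length l \<le> s}"
  proof safe
    fix Y assume "Y \<subseteq> {1..n}"
    then have "set_stream n m (S Y)" using S by simp
    then have "length (memory_after A (take m (S Y))) \<le> s"
      using sp A(1) unfolding uses_space_def by blast
    moreover have "take m (S Y) = S Y" using \<open>set_stream n m (S Y)\<close> by (simp add: set_stream_def)
    ultimately show "length (memory_after A (S Y)) \<le> s" by simp
  qed
  ultimately have "card {Y\<in>?Z. ?Q Y A} \<le> card {l :: bool list. length l \<le> s}"
    by (intro card_inj_on_le finite_bool_lists_length_le)
  also have "\<dots> \<le> 2 ^ Suc s" by (rule card_bool_lists_length_le)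
  finally have "real (card {Y\<in>?Z. ?Q Y A}) \<le> 2 ^ Suc s"
    by (simp only: of_nat_le_numeral_power_cancel_iff)
  with A(2) have "2 / 3 * (2::real) ^ n \<le> 2 ^ Suc s" by (simp add: card_Pow)
  then have "(2::real) ^ n \<le> 3 * 2 ^ s" by simp
  also have "\<dots> \<le> 2 ^ (s + 2)" by (simp add: power_add)
  finally show ?thesis by (subst (asm) power_increasing_iff) simp_all
qed

section \<open>The hard instances and their decoding\<close>

text \<open>The last set of the stream is left out, so that the memory content at this point cannot
  depend on the coordinate \<open>i\<close> queried by it. The empty sets are padding.\<close>

definition split_family :: "nat \<Rightarrow> nat \<Rightarrow> (nat \<Rightarrow> nat set) \<Rightarrow> (nat \<Rightarrow> nat set) \<Rightarrow> nat set list" where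
  "split_family K l X x =
     map (\<lambda>j. if j < 2 * K then if even j then x (j div 2) else X (j div 2) - x (j div 2) else {})
       [0..<l]"

lemma length_split_family [simp]: "length (split_family K l X x) = l"
  by (simp add: split_family_def)

lemma nth_split_family:
  "j < l \<Longrightarrow> split_family K l X x ! j =
     (if j < 2 * K then if even j then x (j div 2) else X (j div 2) - x (j div 2) else {})"
  by (simp add: split_family_def)

lemma set_stream_split_family:
  assumes "\<And>i. i < K \<Longrightarrow> X i \<subseteq> {1..n}" "\<And>i. i < K \<Longrightarrow> x i \<subseteq> X i"
  shows "set_stream n (Suc l) (split_family K l X x @ [{1..n} - X i])"
proof -
  have "(if j < 2 * K then if even j then x (j div 2) else X (j div 2) - x (j div 2) else {}) \<subseteq> {1..n}" for j
  proof (cases "j < 2 * K")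
    case True
    then have "j div 2 < K" by auto
    with assms have "X (j div 2) \<subseteq> {1..n}" "x (j div 2) \<subseteq> X (j div 2)" by blast+
    then show ?thesis by auto
  qed simp
  then have "\<forall>Z\<in>set (split_family K l X x). Z \<subseteq> {1..n}"
    unfolding split_family_def set_map by blast
  then show ?thesis by (simp add: set_stream_def)
qed

lemma set_cover_split_family:
  assumes "i < K" "2 * K \<le> l" "X i \<subseteq> {1..n}" "x i \<subseteq> X i"
  shows "set_cover n (split_family K l X x @ [{1..n} - X i]) {2 * i, 2 * i + 1, l}"
  using assms by (auto simp: set_cover_def nth_append nth_split_family)

text \<open>A wrongly decoded element of \<open>X i\<close> must be certified by a part of some
  other \<open>X j\<close>, hence lies in \<open>X i \<inter> X j\<close>. As the optimum is at most
  3, at most \<open>3 * a\<close> chosen sets can cause such errors.\<close>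

lemma decoding_error_le:
  assumes ans: "approx_answer a n (split_family K l X x @ [{1..n} - X i]) (I, cert)"
    and "a \<ge> 0" "i < K" "2 * K \<le> l"
    and X: "\<And>i. i < K \<Longrightarrow> X i \<subseteq> {1..n}" and x: "\<And>i. i < K \<Longrightarrow> x i \<subseteq> X i"
    and t: "\<And>j. j < K \<Longrightarrow> i \<noteq> j \<Longrightarrow> card (X i \<inter> X j) \<le> t"
  shows "real (card (sym_diff (x i) {e\<in>X i. cert e = 2 * i})) \<le> 3 * a * real t"
proof -
  let ?S = "split_family K l X x @ [{1..n} - X i]"
  let ?G = "{e\<in>X i. cert e = 2 * i}"
  let ?J = "{j\<in>I. j < 2 * K \<and> j div 2 \<noteq> i}"
  have cov: "set_cover n ?S I" and I: "real (card I) \<le> a * real (opt n ?S)"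
    and cert: "\<And>e. e \<in> {1..n} \<Longrightarrow> cert e \<in> I \<and> e \<in> ?S ! cert e"
    using ans by (auto simp: approx_answer_def)
  have "finite I" using cov by (auto simp: set_cover_def intro: finite_subset)
  have "opt n ?S \<le> card {2 * i, 2 * i + 1, l}"
    using assms by (intro opt_le_card set_cover_split_family)
  also have "\<dots> \<le> 3" by (simp add: card_insert_if)
  finally have "a * real (opt n ?S) \<le> a * 3" using \<open>a \<ge> 0\<close> by (intro mult_left_mono) auto
  with I have I3: "real (card I) \<le> 3 * a" by simp
  have "sym_diff (x i) ?G \<subseteq> (\<Union>j\<in>?J. X i \<inter> X (j div 2))"
  proof
    fix e assume e: "e \<in> sym_diff (x i) ?G"
    let ?c = "cert e"
    have eX: "e \<in> X i" using e x[OF \<open>i < K\<close>] by auto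
    then have "e \<in> {1..n}" using X[OF \<open>i < K\<close>] by auto
    from cert[OF this] have c: "?c \<in> I" "e \<in> ?S ! ?c" by auto
    have "?c < Suc l" using c(1) cov by (auto simp: set_cover_def)
    \<comment> \<open>Position \<open>l\<close> holds the complement of \<open>X i\<close>, and the
      positions from \<open>2 * K\<close> up to \<open>l\<close> hold empty sets.\<close>
    then have "?c \<noteq> l" "?c < 2 * K"
      using c(2) eX by (auto simp: nth_append nth_split_family less_Suc_eq split: if_splits)
    then have nth: "?S ! ?c = (if even ?c then x (?c div 2) else X (?c div 2) - x (?c div 2))"
      using \<open>2 * K \<le> l\<close> by (simp add: nth_append nth_split_family)
    \<comment> \<open>A certificate that points to either part of \<open>X i\<close> itself decodes
      \<open>e\<close> correctly.\<close>
    have "?c div 2 \<noteq> i"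
    proof
      assume i: "?c div 2 = i"
      show False
      proof (cases "even ?c")
        case True
        then have "?c = 2 * i" using i by auto
        with e c(2) nth True i eX show False by auto
      next
        case False
        then have "?c \<noteq> 2 * i" by auto
        with e c(2) nth False i show False by auto
      qed
    qed
    moreover have "?c div 2 < K" using \<open>?c < 2 * K\<close> by auto
    then have "e \<in> X (?c div 2)" using c(2) nth x[of "?c div 2"] by (auto split: if_splits)
    ultimately show "e \<in> (\<Union>j\<in>?J. X i \<inter> X (j div 2))"
      using c(1) eX \<open>?c < 2 * K\<close> by blast
  qed
  moreover have "finite (\<Union>j\<in>?J. X i \<inter> X (j div 2))"
    using \<open>finite I\<close> X[OF \<open>i < K\<close>] by (auto intro: finite_subset)
  ultimately have "card (sym_diff (x i) ?G) \<le> card (\<Union>j\<in>?J. X i \<inter> X (j div 2))"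
    by (rule card_mono[rotated])
  also have "\<dots> \<le> (\<Sum>j\<in>?J. card (X i \<inter> X (j div 2)))"
    using \<open>finite I\<close> by (intro card_UN_le) simp
  also have "\<dots> \<le> (\<Sum>j\<in>?J. t)"
    by (intro sum_mono t) auto
  also have "\<dots> \<le> card I * t"
    using \<open>finite I\<close> by (auto intro!: card_mono)
  finally have "real (card (sym_diff (x i) ?G)) \<le> real (card I) * real t"
    by (simp only: of_nat_le_iff flip: of_nat_mult)
  also have "\<dots> \<le> 3 * a * real t" using I3 by (rule mult_right_mono) simp
  finally show ?thesis .
qed

text \<open>One deterministic algorithm is right on two thirds of the pairs of an input
  \<open>x\<close> and a query \<open>i\<close>. By \<open>ratio\<close> its decoding error is then
  at most \<open>r / 16\<close>, so Hamming balls serve as guesses in the counting bound.\<close>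

lemma space_ge_family:
  assumes P: "approximates_set_cover (2 / 3) a n m P" and sp: "uses_space n m P s"
    and "a \<ge> 0" "2 * K < m" and ratio: "48 * a * real t \<le> real r"
    and X: "\<And>i. i < K \<Longrightarrow> X i \<subseteq> {1..n} \<and> card (X i) = r"
    and t: "\<And>i j. i < K \<Longrightarrow> j < K \<Longrightarrow> i \<noteq> j \<Longrightarrow> card (X i \<inter> X j) \<le> t"
  shows "K * r \<le> 4 * (s + K + 3)"
proof -
  define l where "l = m - 1"
  have l: "m = Suc l" "2 * K \<le> l" using \<open>2 * K < m\<close> by (auto simp: l_def)
  define U where "U = PiE {..<K} (\<lambda>i. Pow (X i))"
  define S where "S x i = split_family K l X x @ [{1..n} - X i]" for x i
  define Q where "Q z A \<longleftrightarrow> approx_answer a n (S (fst z) (snd z)) (result A (S (fst z) (snd z)))" for z A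
  have finX: "finite (X i)" if "i < K" for i using X[OF that] by (auto intro: finite_subset)
  have finU: "finite U" using finX by (auto simp: U_def intro!: finite_PiE)
  have U: "x i \<subseteq> X i" if "x \<in> U" "i < K" for x i using that by (auto simp: U_def PiE_iff)
  have S: "set_stream n m (S x i)" if "x \<in> U" for x i
    unfolding S_def l(1) using X U[OF that] by (intro set_stream_split_family) auto
  have "set_cover n (S x i) {2 * i, 2 * i + 1, l}" if "x \<in> U" "i < K" for x i
    unfolding S_def using that l X U[OF that] by (intro set_cover_split_family) auto
  with S P have "2 / 3 \<le> measure_pmf.prob P {A. approx_answer a n (S x i) (result A (S x i))}"
    if "x \<in> U" "i < K" for x i
    using that unfolding approximates_set_cover_def by blast
  then have "2 / 3 \<le> measure_pmf.prob P {A. Q z A}" if "z \<in> U \<times> {..<K}" for z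
    using that by (auto simp: Q_def)
  then obtain A where A: "A \<in> set_pmf P"
    "2 / 3 * real (card (U \<times> {..<K})) \<le> real (card {z\<in>U \<times> {..<K}. Q z A})"
    using exists_good_realisation[of "U \<times> {..<K}" "2 / 3" P Q] finU by auto
  define mem where "mem x = memory_after A (split_family K l X x)" for x
  \<comment> \<open>The last transition can be simulated on one and the same memory content
    \<open>M\<close> for every possible last set, so \<open>M\<close> serves all queries
    \<open>i\<close>.\<close>
  define G where "G M i = {e\<in>X i. snd (answer_of A (update_mem A l M ({1..n} - X i))) e = 2 * i}" for M i
  define guess where "guess M i = {Y. Y \<subseteq> X i \<and> card (sym_diff Y (G M i)) \<le> r div 16}" for M i
  have len: "length (mem x) \<le> s" if "x \<in> U" for x
  proof -
    \<comment> \<open>The query 0 is arbitrary: the first \<open>l\<close> sets do not involve it,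
      and the stream is valid even if \<open>K = 0\<close>.\<close>
    have "take l (S x 0) = split_family K l X x" by (simp add: S_def)
    moreover have "length (memory_after A (take l (S x 0))) \<le> s"
      using sp A(1) S[OF that] l(1) unfolding uses_space_def by simp
    ultimately show ?thesis by (simp add: mem_def)
  qed
  have small: "guess M i \<subseteq> Pow (X i) \<and> (card (guess M i))\<^sup>2 \<le> 2 ^ r" if "i < K" for M i
  proof
    show "guess M i \<subseteq> Pow (X i)" by (auto simp: guess_def)
    show "(card (guess M i))\<^sup>2 \<le> 2 ^ r"
      unfolding guess_def using X[OF that] finX[OF that] by (intro card_hamming_ball_le) (auto simp: G_def)
  qed
  have hit: "x i \<in> guess (mem x) i" if "x \<in> U" "i < K" "Q (x, i) A" for x i
  proof -
    let ?ans = "result A (S x i)"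
    have "?ans = answer_of A (update_mem A l (mem x) ({1..n} - X i))"
      by (simp add: result_def S_def memory_after_snoc mem_def)
    then have G: "G (mem x) i = {e\<in>X i. snd ?ans e = 2 * i}" by (simp add: G_def)
    have "approx_answer a n (split_family K l X x @ [{1..n} - X i]) (fst ?ans, snd ?ans)"
      using that(3) by (simp add: Q_def S_def)
    from decoding_error_le[OF this \<open>a \<ge> 0\<close> \<open>i < K\<close> l(2) _ U[OF that(1)], of t]
    have "real (card (sym_diff (x i) (G (mem x) i))) \<le> 3 * a * real t"
      using X t that(2) by (simp add: G)
    then have "real (16 * card (sym_diff (x i) (G (mem x) i))) \<le> real r" using ratio by simp
    then have "16 * card (sym_diff (x i) (G (mem x) i)) \<le> r" by (simp only: of_nat_le_iff)
    then show ?thesis using U[OF that(1,2)] by (simp add: guess_def less_eq_div_iff_mult_less_eq)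
  qed
  let ?W = "{(x, i) \<in> U \<times> {..<K}. x i \<in> guess (mem x) i}"
  have "{z\<in>U \<times> {..<K}. Q z A} \<subseteq> ?W"
    using hit by auto
  moreover have "finite ?W"
    using finU by (rule finite_subset[rotated, OF finite_cartesian_product[OF _ finite_lessThan[of K]]]) blast
  ultimately have "card {z\<in>U \<times> {..<K}. Q z A} \<le> card ?W"
    by (rule card_mono[rotated])
  moreover have "card (U \<times> {..<K}) = card U * K" by (simp only: card_cartesian_product card_lessThan)
  ultimately have "2 * (card U * K) \<le> 3 * card ?W"
    using A(2) by linarith
  moreover have "finite (X i) \<and> card (X i) = r" if "i < K" for i
    using X finX that by blast
  ultimately show ?thesis
    using len small unfolding U_def by (intro memory_lower_bound[where mem = mem and guess = guess and X = X])
qed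

section \<open>Choice of the parameters and asymptotics\<close>

text \<open>The bound on \<open>n\<close> gives \<open>r / (48 * a) \<ge> 2\<close>, so rounding
  down to \<open>t\<close> loses at most half; the bound on \<open>m\<close> then gives
  \<open>m \<le> 2 ^ t\<close>, enough for the greedy family.\<close>

lemma space_lower_bound:
  fixes n m s :: nat and a :: real
  assumes P: "approximates_set_cover (2 / 3) a n m P" and sp: "uses_space n m P s"
    and "a \<ge> 1" "m \<ge> 2" and n: "110784 * a\<^sup>2 \<le> real n"
    and m: "real m \<le> 2 powr (real n / (110784 * a\<^sup>2))"
  shows "real m * real n / a \<le> 36928 * real s"
proof (cases "m = 2")
  case True
  have "n \<le> s + 2" using space_ge_universe[OF P sp \<open>m \<ge> 2\<close>] .
  moreover have "1 \<le> a\<^sup>2" using \<open>a \<ge> 1\<close> by simp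
  then have "real n \<ge> 4" using n by linarith
  \<comment> \<open>From \<open>n \<ge> 4\<close>, the additive 2 is at most
    \<open>n / 2\<close>.\<close>
  ultimately have "2 * real n \<le> 4 * real s" by linarith
  moreover have "real m * real n / a \<le> 2 * real n"
    using True \<open>a \<ge> 1\<close> by (simp add: divide_le_eq mult_le_cancel_left1)
  ultimately show ?thesis by linarith
next
  case False
  \<comment> \<open>As \<open>t\<close> will be at least \<open>r / (96 * a)\<close>, the condition
    \<open>6 * r \<le> t * q\<close> asks for \<open>q \<ge> 576 * a\<close>.\<close>
  define q where "q = nat \<lceil>576 * a\<rceil>"
  define r where "r = n div q"
  \<comment> \<open>The largest \<open>t\<close> with \<open>3 * a * t \<le> r / 16\<close>.\<close>
  define t where "t = nat \<lfloor>real r / (48 * a)\<rfloor>"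
  \<comment> \<open>Two positions per \<open>X i\<close>, and one kept free for the last
    set.\<close>
  define K where "K = (m - 1) div 2"
  have "a > 0" using \<open>a \<ge> 1\<close> by simp
  have q: "576 * a \<le> real q" "real q \<le> 577 * a"
    using \<open>a \<ge> 1\<close> by (auto simp: q_def intro: order.trans[OF of_int_ceiling_le_add_one])
  have "q > 0" using q \<open>a > 0\<close> by (intro gr0I) auto
  have "a \<le> a\<^sup>2" using \<open>a \<ge> 1\<close> by (simp add: power2_eq_square)
  with q n have "real q \<le> real n" by linarith
  then have "q \<le> n" by simp
  then have "r \<ge> 1" using \<open>q > 0\<close> by (simp add: r_def Suc_le_eq div_greater_zero_iff)
  have "n < q * Suc r" using \<open>q > 0\<close> by (simp add: r_def dividend_less_times_div)
  also have "\<dots> \<le> q * (2 * r)" using \<open>r \<ge> 1\<close> by (intro mult_left_mono) auto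
  finally have "real n \<le> real (q * (2 * r))" by (simp only: of_nat_le_iff less_imp_le)
  then have "real n \<le> real q * (2 * real r)" by simp
  also have "\<dots> \<le> 577 * a * (2 * real r)" using q by (intro mult_right_mono) auto
  finally have nr: "real n \<le> 1154 * a * real r" by simp
  define z where "z = real r / (48 * a)"
  \<comment> \<open>Here 110784 is 96 times 1154, the latter from \<open>nr\<close>.\<close>
  have y: "real n / (110784 * a\<^sup>2) \<le> z / 2"
    using nr \<open>a > 0\<close> by (simp add: z_def field_simps power2_eq_square)
  have "1 \<le> real n / (110784 * a\<^sup>2)" using n \<open>a > 0\<close> by (simp add: le_divide_eq)
  then have "1 \<le> z / 2" using y by (rule order.trans)
  then have y2: "2 \<le> z" by simp
  then have r96: "96 * a \<le> real r" using \<open>a > 0\<close> by (simp add: z_def field_simps)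
  have t: "real t \<le> z" "z / 2 \<le> real t"
    unfolding t_def z_def[symmetric] using y2 by linarith+
  have "t > 0" using t y2 by linarith
  have ratio: "48 * a * real t \<le> real r" using t(1) \<open>a > 0\<close> by (simp add: z_def field_simps)
  have "1 * real t \<le> 48 * a * real t" using \<open>a \<ge> 1\<close> by (intro mult_right_mono) auto
  with ratio have "real t \<le> real r" by linarith
  then have "t \<le> r" by simp
  have "real (6 * r) = z / 2 * (576 * a)" using \<open>a > 0\<close> by (simp add: z_def)
  also have "\<dots> \<le> real t * real q" using t q \<open>a > 0\<close> by (intro mult_mono) auto
  finally have "6 * r \<le> t * q" by (simp only: of_nat_le_iff flip: of_nat_mult)
  have "real m \<le> 2 powr real t"
    by (rule order.trans[OF m]) (rule powr_mono, rule order.trans[OF y t(2)], simp)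
  then have "real m \<le> real (2 ^ t)" by (simp add: powr_realpow)
  then have "m \<le> 2 ^ t" by (simp only: of_nat_le_iff)
  then have "K \<le> 2 ^ t" by (simp add: K_def)
  have "r * q \<le> n" by (simp add: r_def)
  from exists_nearly_disjoint_family[OF \<open>t > 0\<close> \<open>t \<le> r\<close> \<open>6 * r \<le> t * q\<close> this \<open>K \<le> 2 ^ t\<close>]
  obtain X where X: "\<forall>i<K. X i \<subseteq> {1..n} \<and> card (X i) = r"
    "\<forall>i<K. \<forall>j<K. i \<noteq> j \<longrightarrow> card (X i \<inter> X j) < t"
    by blast
  define p where "p = K * r"
  have "p \<le> 4 * (s + K + 3)"
    unfolding p_def using X \<open>a > 0\<close> False \<open>m \<ge> 2\<close>
    by (intro space_ge_family[OF P sp _ _ ratio, where X = X]) (auto simp: K_def less_imp_le)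
  moreover have K: "K \<ge> 1" "m \<le> 4 * K" using False \<open>m \<ge> 2\<close> unfolding K_def by presburger+
  moreover have "r \<ge> 32" using r96 \<open>a \<ge> 1\<close> by linarith
  then have "K * 32 \<le> p" unfolding p_def by (rule mult_left_mono) simp
  \<comment> \<open>By \<open>K \<ge> 1\<close> the additive 12 is absorbed into
    \<open>16 * K\<close>, which is at most half of \<open>p\<close>.\<close>
  ultimately have "p \<le> 4 * s + 16 * K" "32 * K \<le> p" by simp_all
  then have "p \<le> 8 * s" by simp
  have "real m \<le> real (4 * K)" using K(2) by linarith
  then have "real m * real n / a \<le> real (4 * K) * (1154 * a * real r) / a"
    using nr \<open>a > 0\<close> by (intro divide_right_mono mult_mono) simp_all
  also have "\<dots> = 4616 * real p" using \<open>a > 0\<close> by (simp add: p_def)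
  also have "\<dots> \<le> 4616 * real (8 * s)"
    using \<open>p \<le> 8 * s\<close> by (intro mult_left_mono of_nat_mono) simp_all
  finally show ?thesis by simp
qed

theorem theorem3p1:
  fixes \<alpha> :: "nat \<Rightarrow> real" and m :: "nat \<Rightarrow> nat" and d :: nat
    and P :: "nat \<Rightarrow> rand_stream_alg" and s :: "nat \<Rightarrow> nat"
  assumes "\<alpha> \<in> o(\<lambda>n. sqrt (real n) / ln (real n))"
    and "(\<lambda>n. real (m n)) \<in> O(\<lambda>n. real n ^ d)"
    and "\<forall>\<^sub>F n in sequentially. m n \<ge> 2"
    and "\<forall>\<^sub>F n in sequentially. approximates_set_cover (2 / 3) (\<alpha> n) n (m n) (P n)"
    and "\<forall>\<^sub>F n in sequentially. uses_space n (m n) (P n) (s n)"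
  shows "(\<lambda>n. real (s n)) \<in> \<Omega>(\<lambda>n. real (m n) * real n / \<alpha> n)"
proof -
  obtain C where "C > 0" and C: "\<forall>\<^sub>F n in sequentially. norm (real (m n)) \<le> C * norm (real n ^ d)"
    using assms(2) by (elim landau_o.bigE)
  \<comment> \<open>221568 is twice 110784; the factor 2 pays for \<open>ln 2 \<ge> 1 / 2\<close>.
    Once \<open>ln n\<close> exceeds \<open>M\<close>, the exponent \<open>C + d * ln n\<close> of
    the polynomial bound is below \<open>(ln n) ^ 2 / 221568\<close>.\<close>
  define M where "M = 221568 * (C + real d + 1)"
  have "M \<ge> 221568" using \<open>C > 0\<close> by (simp add: M_def)
  have "filterlim (\<lambda>n. ln (real n)) at_top sequentially"
    by (rule filterlim_compose[OF ln_at_top filterlim_real_sequentially])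
  then have L: "\<forall>\<^sub>F n in sequentially. M \<le> ln (real n)"
    by (simp add: filterlim_at_top)
  have "\<forall>\<^sub>F n in sequentially. norm (\<alpha> n) \<le> 1 * norm (sqrt (real n) / ln (real n))"
    using landau_o.smallD[OF assms(1), of 1] by simp
  then have "\<forall>\<^sub>F n in sequentially. norm (real (s n)) \<ge> 1 / 36928 * norm (real (m n) * real n / \<alpha> n)"
    using assms(3-5) C L eventually_gt_at_top[of 0]
  proof eventually_elim
    case (elim n)
    define l where "l = ln (real n)"
    have a: "\<alpha> n \<ge> 1"
      using elim by (intro approximation_ratio_ge_1[of "2/3" _ n "m n" "P n"]) auto
    have l: "l \<ge> M" "l \<ge> 221568" using elim \<open>M \<ge> 221568\<close> by (auto simp: l_def)
    \<comment> \<open>The logarithm in the growth condition makes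
      \<open>n / (\<alpha> n) ^ 2\<close> at least \<open>l ^ 2\<close>, which outgrows the
      logarithm of any polynomial in \<open>n\<close>.\<close>
    have "\<alpha> n \<le> sqrt (real n) / l" using elim a l by (simp add: l_def)
    then have "(\<alpha> n)\<^sup>2 \<le> (sqrt (real n) / l)\<^sup>2" using a by (intro power_mono) auto
    also have "\<dots> = real n / l\<^sup>2" by (simp add: power_divide)
    finally have al: "(\<alpha> n)\<^sup>2 * l\<^sup>2 \<le> real n" using l by (simp add: field_simps)
    have l2: "221568 * l \<le> l\<^sup>2"
      unfolding power2_eq_square using l by (intro mult_right_mono) auto
    have "110784 * (\<alpha> n)\<^sup>2 \<le> l\<^sup>2 * (\<alpha> n)\<^sup>2"
      using l l2 by (intro mult_right_mono) auto
    then have n: "110784 * (\<alpha> n)\<^sup>2 \<le> real n" using al by (simp add: mult.commute)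
    have "l\<^sup>2 / 110784 \<le> real n / (110784 * (\<alpha> n)\<^sup>2)"
      using al a by (simp add: field_simps)
    then have y: "2 powr (l\<^sup>2 / 110784) \<le> 2 powr (real n / (110784 * (\<alpha> n)\<^sup>2))"
      by (intro powr_mono) auto
    have "real (m n) \<le> C * real n ^ d" using elim by simp
    also have "\<dots> \<le> exp C * real n ^ d"
      using order.trans[OF _ exp_ge_add_one_self, of C C] by (intro mult_right_mono) simp_all
    also have "real n = exp l" using elim by (simp add: l_def)
    also have "exp C * exp l ^ d = exp (C + real d * l)"
      by (simp add: exp_add exp_of_nat_mult)
    also have "\<dots> \<le> exp (l\<^sup>2 / 221568)"
    proof -
      have "C * 1 \<le> C * l" using \<open>C > 0\<close> l by (intro mult_left_mono) auto
      then have "C + real d * l \<le> (C + real d + 1) * l" using l by (simp add: algebra_simps)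
      also have "\<dots> \<le> l / 221568 * l" using l by (intro mult_right_mono) (auto simp: M_def)
      finally show ?thesis by (simp add: power2_eq_square)
    qed
    also have "\<dots> \<le> exp (l\<^sup>2 / 110784 * ln 2)"
    proof -
      have "1 / 2 \<le> ln (2::real)" using ln_le_minus_one[of "1 / 2 :: real"] by (simp add: ln_div)
      then have "l\<^sup>2 / 110784 * (1 / 2) \<le> l\<^sup>2 / 110784 * ln 2" by (intro mult_left_mono) auto
      then show ?thesis by simp
    qed
    also have "\<dots> = 2 powr (l\<^sup>2 / 110784)" by (simp add: powr_def)
    also note y
    finally have "real (m n) \<le> 2 powr (real n / (110784 * (\<alpha> n)\<^sup>2))" by simp
    from space_lower_bound[OF _ _ a _ n this] elim
    have "real (m n) * real n / \<alpha> n \<le> 36928 * real (s n)" by blast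
    then show ?case using a by simp
  qed
  then show ?thesis by (intro landau_omega.bigI[of "1 / 36928"]) auto
qed

end
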